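(* For integers $m\ge n\ge 2$, $ub(K_{m,n})\ge \lceil m/5\rceil$.
   Context: $K_{m,n}$ is the complete bipartite graph with parts of sizes $m$ and $n$. A bar is a closed horizontal line segment of length $1$ in the plane. Two bars of an arrangement of pairwise disjoint bars see each other if there is an axis-parallel rectangle of positive width whose bottom side lies in one of them, whose top side lies in the other, and whose interior meets no bar of the arrangement. For a nonnegative integer $t$, a $t$-unit-bar visibility representation of a graph $G$ assigns to each vertex a set of at most $t$ bars, all bars pairwise disjoint, such that two distinct vertices are adjacent iff some bar of one sees some bar of the other; $ub(G)$ is the minimum such $t$. *)

theory Defs
  imports Complex_Main "HOL-Library.Disjoint_Sets" "HOL-Library.Nat_Bijection"
    "Graph_Theory.Kuratowski"
begin

definition unit_bar :: "(real \<times> real) set \<Rightarrow> bool" where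
  "unit_bar b \<longleftrightarrow> (\<exists>x y. b = {x..x + 1} \<times> {y})"

text \<open>The rectangle is \<open>{l..r} \<times> {y..z}\<close>; its bottom side lies in \<open>b\<close> and its top side
  in \<open>c\<close>. The first argument is the set of all bars of the arrangement.\<close>

definition sees_above :: "(real \<times> real) set set \<Rightarrow> (real \<times> real) set \<Rightarrow> (real \<times> real) set \<Rightarrow> bool" where
  "sees_above B b c \<longleftrightarrow>
    (\<exists>l r y z. l < r \<and> y < z \<and> {l..r} \<times> {y} \<subseteq> b \<and> {l..r} \<times> {z} \<subseteq> c \<and>
      (\<forall>d\<in>B. ({l<..<r} \<times> {y<..<z}) \<inter> d = {}))"

definition sees :: "(real \<times> real) set set \<Rightarrow> (real \<times> real) set \<Rightarrow> (real \<times> real) set \<Rightarrow> bool" where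
  "sees B b c \<longleftrightarrow> sees_above B b c \<or> sees_above B c b"

text \<open>Disjointness is stated for the family of all bars indexed by (vertex, bar), so that it
  also forbids one bar being assigned to two vertices. The finiteness condition is needed because
  \<open>card\<close> is \<open>0\<close> on infinite sets. Graphs are the symmetric digraphs of the \<open>graph\<close> locale.\<close>

definition unit_bar_rep ::
    "nat \<Rightarrow> ('a, 'b) pre_digraph \<Rightarrow> ('a \<Rightarrow> (real \<times> real) set set) \<Rightarrow> bool" where
  "unit_bar_rep t G R \<longleftrightarrow>
    (\<forall>v\<in>verts G. finite (R v) \<and> card (R v) \<le> t \<and> (\<forall>b\<in>R v. unit_bar b)) \<and>
    disjoint_family_on snd (Sigma (verts G) R) \<and>
    (\<forall>u\<in>verts G. \<forall>v\<in>verts G. u \<noteq> v \<longrightarrow>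
      (u \<rightarrow>\<^bsub>G\<^esub> v \<longleftrightarrow> (\<exists>b\<in>R u. \<exists>c\<in>R v. sees (\<Union>w\<in>verts G. R w) b c)))"

definition ub :: "('a, 'b) pre_digraph \<Rightarrow> nat" where
  "ub G = (LEAST t. \<exists>R. unit_bar_rep t G R)"

text \<open>Every finite graph has a representation, so the minimum is attained: put the two bars of
  each edge above each other, far away from the bars of all other edges.\<close>

lemma ex_unit_bar_rep:
  fixes G :: "('a, 'b) pre_digraph"
  assumes "graph G"
  shows "\<exists>t R. unit_bar_rep t G R"
proof -
  interpret graph G by fact
  obtain i :: "'a \<Rightarrow> nat" where i: "inj_on i (verts G)"
    using finite_imp_inj_to_nat_seg[OF finite_verts] by blast
  define E where "E m n = 2 * real (prod_encode (m, n))" for m n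
  define bar where "bar x y = {x..x + 1} \<times> {y}" for x y :: real
  define lo where "lo u = {v \<in> verts G. u \<rightarrow>\<^bsub>G\<^esub> v \<and> i u < i v}" for u
  define hi where "hi u = {v \<in> verts G. u \<rightarrow>\<^bsub>G\<^esub> v \<and> i v < i u}" for u
  define R where "R u = (\<lambda>v. bar (E (i u) (i v)) 0) ` lo u \<union> (\<lambda>v. bar (E (i v) (i u)) 1) ` hi u" for u
  define B where "B = (\<Union>w\<in>verts G. R w)"
  have E_close: "a = c \<and> b = d" if "E a b < E c d + 2" "E c d < E a b + 2" for a b c d
  proof -
    have "prod_encode (a, b) = prod_encode (c, d)"
      using that unfolding E_def by linarith
    then show ?thesis by simp
  qed
  have sym: "v \<rightarrow>\<^bsub>G\<^esub> u" if "u \<rightarrow>\<^bsub>G\<^esub> v" for u v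
    using sym_arcs that unfolding symmetric_def by (meson symD)
  have fin: "finite (R u)" for u
    unfolding R_def lo_def hi_def using finite_verts by simp
  have height: "\<exists>x y. b = bar x y \<and> y \<in> {0, 1}" if "b \<in> R u" for b u
    using that unfolding R_def by auto
  have heightB: "snd p \<in> {0, 1}" if "b \<in> B" "p \<in> b" for b p
    using that height unfolding B_def bar_def by fastforce
  have R_cases: "\<exists>v\<in>verts G. u \<rightarrow>\<^bsub>G\<^esub> v \<and>
      (b = bar (E (i u) (i v)) 0 \<and> i u < i v \<or> b = bar (E (i v) (i u)) 1 \<and> i v < i u)"
    if "b \<in> R u" for b u
    using that unfolding R_def lo_def hi_def by auto
  have disj: "disjoint_family_on snd (Sigma (verts G) R)"
    unfolding disjoint_family_on_def
  proof (intro ballI impI)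
    fix p q assume p: "p \<in> Sigma (verts G) R" and q: "q \<in> Sigma (verts G) R" and ne: "p \<noteq> q"
    obtain u b v c where pq: "p = (u, b)" "q = (v, c)" by (cases p, cases q)
    have uv: "u \<in> verts G" "v \<in> verts G" and bc: "b \<in> R u" "c \<in> R v"
      using p q pq by auto
    show "snd p \<inter> snd q = {}"
    proof (rule ccontr)
      assume "snd p \<inter> snd q \<noteq> {}"
      then obtain x y where xy: "(x, y) \<in> b" "(x, y) \<in> c" using pq by auto
      obtain u' where u': "u' \<in> verts G"
        "b = bar (E (i u) (i u')) 0 \<and> i u < i u' \<or> b = bar (E (i u') (i u)) 1 \<and> i u' < i u"
        using R_cases[OF bc(1)] by blast
      obtain v' where v': "v' \<in> verts G"
        "c = bar (E (i v) (i v')) 0 \<and> i v < i v' \<or> c = bar (E (i v') (i v)) 1 \<and> i v' < i v"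
        using R_cases[OF bc(2)] by blast
      have ii: "i u = i v \<and> i u' = i v'"
        using u'(2) v'(2) xy E_close[of "i u" "i u'" "i v" "i v'"] E_close[of "i u'" "i u" "i v'" "i v"]
        by (auto simp: bar_def)
      then have "u = v" using i uv by (auto dest: inj_onD)
      moreover have "b = c" using u'(2) v'(2) ii by auto
      ultimately show False using ne pq by simp
    qed
  qed
  have adj_above: "u \<rightarrow>\<^bsub>G\<^esub> v" if b: "b \<in> R u" and c: "c \<in> R v" and uv: "u \<in> verts G" "v \<in> verts G"
    and s: "sees_above B b c" for u v b c
  proof -
    obtain l r y z where lr: "l < r" "y < z" "{l..r} \<times> {y} \<subseteq> b" "{l..r} \<times> {z} \<subseteq> c"
      using s unfolding sees_above_def by blast
    then have in_bc: "(l, y) \<in> b" "(l, z) \<in> c" by auto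
    obtain u' where u': "u' \<in> verts G" "u \<rightarrow>\<^bsub>G\<^esub> u'"
      "b = bar (E (i u) (i u')) 0 \<and> i u < i u' \<or> b = bar (E (i u') (i u)) 1 \<and> i u' < i u"
      using R_cases[OF b] by blast
    obtain v' where v': "v' \<in> verts G"
      "c = bar (E (i v) (i v')) 0 \<and> i v < i v' \<or> c = bar (E (i v') (i v)) 1 \<and> i v' < i v"
      using R_cases[OF c] by blast
    have "i u' = i v"
      using u'(3) v'(2) in_bc lr(2) E_close[of "i u" "i u'" "i v'" "i v"]
      by (auto simp: bar_def)
    then have "u' = v" using i uv u'(1) by (auto dest: inj_onD)
    then show ?thesis using u'(2) by simp
  qed
  have above_adj: "\<exists>b\<in>R u. \<exists>c\<in>R v. sees_above B b c"
    if uv: "u \<in> verts G" "v \<in> verts G" "u \<rightarrow>\<^bsub>G\<^esub> v" "i u < i v" for u v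
  proof -
    let ?x = "E (i u) (i v)"
    have "bar ?x 0 \<in> R u" using uv unfolding R_def lo_def by blast
    moreover have "bar ?x 1 \<in> R v" using uv sym unfolding R_def hi_def by blast
    moreover have "sees_above B (bar ?x 0) (bar ?x 1)"
    proof -
      have "({?x<..<?x + 1} \<times> {0<..<1}) \<inter> d = {}" if "d \<in> B" for d
        using heightB[OF that] by fastforce
      then show ?thesis unfolding sees_above_def bar_def
        by (intro exI[of _ ?x] exI[of _ "?x + 1"] exI[of _ 0] exI[of _ 1]) auto
    qed
    ultimately show ?thesis by blast
  qed
  have adj: "u \<rightarrow>\<^bsub>G\<^esub> v \<longleftrightarrow> (\<exists>b\<in>R u. \<exists>c\<in>R v. sees B b c)"
    if uv: "u \<in> verts G" "v \<in> verts G" "u \<noteq> v" for u v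
  proof
    assume a: "u \<rightarrow>\<^bsub>G\<^esub> v"
    have "i u \<noteq> i v" using i uv by (auto dest: inj_onD)
    then consider "i u < i v" | "i v < i u" by linarith
    then show "\<exists>b\<in>R u. \<exists>c\<in>R v. sees B b c"
    proof cases
      case 1 then show ?thesis using above_adj[OF uv(1,2) a] unfolding sees_def by blast
    next
      case 2 then show ?thesis using above_adj[OF uv(2,1) sym[OF a]] unfolding sees_def by blast
    qed
  next
    assume "\<exists>b\<in>R u. \<exists>c\<in>R v. sees B b c"
    then show "u \<rightarrow>\<^bsub>G\<^esub> v" using adj_above uv(1,2) sym unfolding sees_def by blast
  qed
  have bars: "unit_bar b" if "b \<in> R u" for b u
    using height[OF that] unfolding unit_bar_def bar_def by blast
  have "card (R v) \<le> (\<Sum>w\<in>verts G. card (R w))" if "v \<in> verts G" for v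
    by (rule member_le_sum[OF that]) simp_all
  then have "unit_bar_rep (\<Sum>w\<in>verts G. card (R w)) G R"
    unfolding unit_bar_rep_def using fin bars disj adj unfolding B_def by blast
  then show ?thesis by blast
qed

lemma unit_bar_rep_ub: "graph G \<Longrightarrow> \<exists>R. unit_bar_rep (ub G) G R"
  unfolding ub_def by (rule LeastI_ex) (rule ex_unit_bar_rep)

end

theory Submission
  imports Defs
begin

text \<open>Call the bars of the \<open>n\<close> vertices on the second side hubs. Every pair of a hub vertex \<open>v\<close> and a
  vertex \<open>w\<close> of the other side is charged to an end of a hub. Fix a bar \<open>b\<close> of \<open>v\<close> that sees bars of
  \<open>w\<close>, say above it, and look at the leftmost and the rightmost place where this happens. At such a
  place \<open>b\<close> may end, or a hub between \<open>b\<close> and the bar of \<open>w\<close> ends just outside; otherwise the bar of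
  \<open>w\<close> ends there, because consecutive bars that are not hubs belong to the same vertex. The last
  case cannot occur on both sides because all bars have the same length. An end of a hub receives at
  most three charges: from the channel above it, the channel below it, and the channel that it blocks.
  If the right end is preferred, a left end receives at most two. So there are at most five
  charges per hub, and \<open>m n \<le> 5 n t\<close>.\<close>

section \<open>Consecutive bars on a vertical line just beside a point\<close>

text \<open>A vertical line slightly to the right of \<open>p\<close> meets exactly the bars with
  \<open>l d <= p < l d + 1\<close>. One-sided lines settle what happens where bars end.\<close>

definition next_right :: "'b set \<Rightarrow> ('b \<Rightarrow> real) \<Rightarrow> ('b \<Rightarrow> real) \<Rightarrow> real \<Rightarrow> 'b \<Rightarrow> 'b \<Rightarrow> bool" where
  "next_right B l h p b c \<longleftrightarrow>
    b \<in> B \<and> c \<in> B \<and> l b \<le> p \<and> p < l b + 1 \<and> l c \<le> p \<and> p < l c + 1 \<and> h b < h c \<and>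
    (\<forall>d\<in>B. l d \<le> p \<and> p < l d + 1 \<longrightarrow> \<not> (h b < h d \<and> h d < h c))"

definition next_left :: "'b set \<Rightarrow> ('b \<Rightarrow> real) \<Rightarrow> ('b \<Rightarrow> real) \<Rightarrow> real \<Rightarrow> 'b \<Rightarrow> 'b \<Rightarrow> bool" where
  "next_left B l h p b c \<longleftrightarrow>
    b \<in> B \<and> c \<in> B \<and> l b < p \<and> p \<le> l b + 1 \<and> l c < p \<and> p \<le> l c + 1 \<and> h b < h c \<and>
    (\<forall>d\<in>B. l d < p \<and> p \<le> l d + 1 \<longrightarrow> \<not> (h b < h d \<and> h d < h c))"

lemma next_right_le:
  "\<lbrakk>next_right B l h p b c; d \<in> B; l d \<le> p; p < l d + 1; h b < h d\<rbrakk> \<Longrightarrow> h c \<le> h d"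
  unfolding next_right_def by (meson not_less)

lemma next_left_le:
  "\<lbrakk>next_left B l h p b c; d \<in> B; l d < p; p \<le> l d + 1; h b < h d\<rbrakk> \<Longrightarrow> h c \<le> h d"
  unfolding next_left_def by (meson not_less)

text \<open>The left end of a bar becomes \<open>- l b - 1\<close> under the reflection \<open>x \<mapsto> - x\<close>.\<close>

abbreviation mirror :: "('b \<Rightarrow> real) \<Rightarrow> 'b \<Rightarrow> real" where
  "mirror l \<equiv> \<lambda>b. - l b - 1"

abbreviation flip :: "('b \<Rightarrow> real) \<Rightarrow> 'b \<Rightarrow> real" where
  "flip h \<equiv> \<lambda>b. - h b"

lemma next_right_mirror: "next_right B (mirror l) h p b c \<longleftrightarrow> next_left B l h (- p) b c"
  unfolding next_right_def next_left_def by (smt (verit))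

lemma next_left_mirror: "next_left B (mirror l) h p b c \<longleftrightarrow> next_right B l h (- p) b c"
  unfolding next_right_def next_left_def by (smt (verit))

lemma next_right_flip: "next_right B l (flip h) p b c \<longleftrightarrow> next_right B l h p c b"
  unfolding next_right_def by auto

lemma next_left_flip: "next_left B l (flip h) p b c \<longleftrightarrow> next_left B l h p c b"
  unfolding next_left_def by auto

definition ends :: "'b set \<Rightarrow> ('b \<Rightarrow> real) \<Rightarrow> real set" where
  "ends B l = l ` B \<union> (\<lambda>b. l b + 1) ` B"

lemma finite_ends: "finite B \<Longrightarrow> finite (ends B l)"
  unfolding ends_def by simp

text \<open>The bars met just to the right of a point change only at ends, so the last end up to
  \<open>q\<close> has the same view. Extreme positions thus become minima of finite sets.\<close>

lemma next_right_at_end: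
  assumes "finite B" and n: "next_right B l h q b c"
  shows "\<exists>p\<in>ends B l. p \<le> q \<and> next_right B l h p b c"
proof -
  define S where "S = {x \<in> ends B l. x \<le> q}"
  have fin: "finite S" using finite_ends[OF assms(1)] S_def by simp
  have "l b \<in> S" using n unfolding S_def ends_def next_right_def by auto
  then have M: "Max S \<in> S" using fin Max_in by blast
  have "(l d \<le> Max S \<and> Max S < l d + 1) \<longleftrightarrow> (l d \<le> q \<and> q < l d + 1)" if "d \<in> B" for d
  proof -
    have "l d \<in> ends B l" "l d + 1 \<in> ends B l" using that unfolding ends_def by auto
    then have "l d \<le> q \<Longrightarrow> l d \<le> Max S" "l d + 1 \<le> q \<Longrightarrow> l d + 1 \<le> Max S"
      using Max_ge[OF fin] S_def by auto
    moreover have "Max S \<le> q" using M unfolding S_def by auto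
    ultimately show ?thesis by linarith
  qed
  then have "next_right B l h (Max S) b c" using n unfolding next_right_def by blast
  then show ?thesis using M unfolding S_def by blast
qed

text \<open>No end lies strictly between \<open>q\<close> and the last end before it, so the view
  just left of \<open>q\<close> is the view just right of that end.\<close>

lemma next_left_imp_next_right:
  assumes "finite B" and n: "next_left B l h q b c"
  shows "\<exists>p\<in>ends B l. p < q \<and> next_right B l h p b c"
proof -
  define S where "S = {x \<in> ends B l. x < q}"
  have fin: "finite S" using finite_ends[OF assms(1)] S_def by simp
  have "l b \<in> S" using n unfolding S_def ends_def next_left_def by auto
  then have M: "Max S \<in> S" using fin Max_in by blast
  have "(l d \<le> Max S \<and> Max S < l d + 1) \<longleftrightarrow> (l d < q \<and> q \<le> l d + 1)" if "d \<in> B" for d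
  proof -
    have "l d \<in> ends B l" "l d + 1 \<in> ends B l" using that unfolding ends_def by auto
    then have "l d < q \<Longrightarrow> l d \<le> Max S" "l d + 1 < q \<Longrightarrow> l d + 1 \<le> Max S"
      using Max_ge[OF fin] S_def by auto
    moreover have "Max S < q" using M unfolding S_def by auto
    ultimately show ?thesis by linarith
  qed
  then have "next_right B l h (Max S) b c" using n unfolding next_right_def next_left_def by blast
  then show ?thesis using M unfolding S_def by blast
qed

section \<open>Rectangles versus consecutive bars\<close>

text \<open>The rectangle reaches from \<open>p\<close> to the next end. No bar starts strictly
  inside this width, so a bar meeting the interior would already be present just right of
  \<open>p\<close>.\<close>

lemma next_right_imp_sees_above:
  fixes bar :: "'b \<Rightarrow> (real \<times> real) set"
  assumes "finite B" and bar: "\<And>b. b \<in> B \<Longrightarrow> bar b = {l b..l b + 1} \<times> {h b}"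
    and n: "next_right B l h p b c"
  shows "sees_above (bar ` B) (bar b) (bar c)"
proof -
  define S where "S = {x \<in> ends B l. p < x}"
  have fin: "finite S" using finite_ends[OF assms(1)] S_def by simp
  have b: "b \<in> B" "c \<in> B" "l b + 1 \<in> S" "l c + 1 \<in> S"
    using n unfolding S_def ends_def next_right_def by auto
  then have M: "p < Min S" using fin Min_in S_def by blast
  have le: "Min S \<le> l b + 1" "Min S \<le> l c + 1" using b Min_le[OF fin] by auto
  have "({p<..<Min S} \<times> {h b<..<h c}) \<inter> bar d = {}" if d: "d \<in> B" for d
  proof -
    have "l d \<in> ends B l" "l d + 1 \<in> ends B l" using d unfolding ends_def by auto
    then have "p < l d \<Longrightarrow> Min S \<le> l d" using Min_le[OF fin] S_def by auto
    moreover have "\<not> (l d \<le> p \<and> p < l d + 1 \<and> h b < h d \<and> h d < h c)"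
      using n d unfolding next_right_def by blast
    ultimately show ?thesis unfolding bar[OF d] by fastforce
  qed
  then have "\<forall>d\<in>bar ` B. ({p<..<Min S} \<times> {h b<..<h c}) \<inter> d = {}" by blast
  moreover have "h b < h c" "l b \<le> p" "l c \<le> p" using n unfolding next_right_def by simp_all
  then have "h b < h c" "{p..Min S} \<times> {h b} \<subseteq> bar b" "{p..Min S} \<times> {h c} \<subseteq> bar c"
    unfolding bar[OF b(1)] bar[OF b(2)] using le by (simp_all add: Sigma_mono)
  ultimately show ?thesis unfolding sees_above_def using M by blast
qed

text \<open>The left side of the rectangle serves as \<open>p\<close>: a bar between the two just to
  the right of it would enter the interior.\<close>

lemma sees_above_imp_next_right:
  fixes bar :: "'b \<Rightarrow> (real \<times> real) set"
  assumes bar: "\<And>b. b \<in> B \<Longrightarrow> bar b = {l b..l b + 1} \<times> {h b}"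
    and bc: "b \<in> B" "c \<in> B" and s: "sees_above (bar ` B) (bar b) (bar c)"
  shows "\<exists>p. next_right B l h p b c"
proof -
  obtain x r y z where x: "x < r" "y < z" "{x..r} \<times> {y} \<subseteq> bar b" "{x..r} \<times> {z} \<subseteq> bar c"
    and e: "\<And>d. d \<in> B \<Longrightarrow> ({x<..<r} \<times> {y<..<z}) \<inter> bar d = {}"
    using s unfolding sees_above_def by auto
  have "(x, y) \<in> bar b" "(r, y) \<in> bar b" "(x, z) \<in> bar c" "(r, z) \<in> bar c"
    using x by auto
  then have y: "y = h b" "z = h c" and le: "l b \<le> x" "r \<le> l b + 1" "l c \<le> x" "r \<le> l c + 1"
    using bar bc by auto
  have False if d: "d \<in> B" "l d \<le> x" "x < l d + 1" "h b < h d" "h d < h c" for d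
  proof -
    \<comment> \<open>The midpoint is strictly inside the rectangle and still covered by
      \<open>d\<close>.\<close>
    define u where "u = (x + min r (l d + 1)) / 2"
    have "(u, h d) \<in> ({x<..<r} \<times> {y<..<z}) \<inter> bar d"
      using d x(1) y unfolding bar[OF d(1)] u_def by (auto simp: min_def)
    then show False using e[OF d(1)] by blast
  qed
  then show ?thesis unfolding next_right_def using bc le x y by (intro exI[of _ x]) auto
qed

section \<open>Charges received by a hub\<close>

definition start :: "'b set \<Rightarrow> ('b \<Rightarrow> real) \<Rightarrow> ('b \<Rightarrow> real) \<Rightarrow> ('b \<Rightarrow> 'v) \<Rightarrow> 'b \<Rightarrow> ('v \<times> 'v) set" where
  "start B l h lab e = {(lab e, lab c) |c. next_right B l h (l e) e c}"

text \<open>Strictness makes \<open>c\<close> present just left of the left end of \<open>e\<close>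
  as well, where it competes with the channel that \<open>e\<close> blocks.\<close>

definition start_strict :: "'b set \<Rightarrow> ('b \<Rightarrow> real) \<Rightarrow> ('b \<Rightarrow> real) \<Rightarrow> ('b \<Rightarrow> 'v) \<Rightarrow> 'b \<Rightarrow> ('v \<times> 'v) set" where
  "start_strict B l h lab e = {(lab e, lab c) |c. next_right B l h (l e) e c \<and> l c < l e}"

text \<open>The channel between \<open>b\<close> and \<open>c\<close> is cut off by the left end of
  \<open>e\<close>, and both bars continue beyond that end. The right end is reached through
  \<open>mirror\<close>, a hub on top through \<open>flip\<close>.\<close>

definition across ::
    "'b set \<Rightarrow> ('b \<Rightarrow> real) \<Rightarrow> ('b \<Rightarrow> real) \<Rightarrow> ('b \<Rightarrow> 'v) \<Rightarrow> 'v set \<Rightarrow> 'b \<Rightarrow> ('v \<times> 'v) set" where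
  "across B l h lab X e =
    {(lab b, lab c) |b c. next_left B l h (l e) b c \<and> l e < l b + 1 \<and> l e < l c + 1 \<and>
      h b < h e \<and> h e < h c \<and> lab b \<in> X \<and> lab c \<notin> X}"

text \<open>The left end uses \<open>start_strict\<close> and the right end, in mirrored form,
  \<open>start\<close>. This asymmetry gives 2 + 3 charges.\<close>

definition charge ::
    "'b set \<Rightarrow> ('b \<Rightarrow> real) \<Rightarrow> ('b \<Rightarrow> real) \<Rightarrow> ('b \<Rightarrow> 'v) \<Rightarrow> 'v set \<Rightarrow> 'b \<Rightarrow> ('v \<times> 'v) set" where
  "charge B l h lab X e =
    (start_strict B l h lab e \<union> start_strict B l (flip h) lab e \<union>
      (across B l h lab X e \<union> across B l (flip h) lab X e) \<union>
    (start B (mirror l) h lab e \<union> start B (mirror l) (flip h) lab e \<union>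
      (across B (mirror l) h lab X e \<union> across B (mirror l) (flip h) lab X e))) \<inter> X \<times> (- X)"

lemma charge_flip: "charge B l (flip h) lab X e = charge B l h lab X e"
  unfolding charge_def by auto

text \<open>\<open>X\<close> is the set of hub vertices. The last two assumptions express that the
  other side is independent; both one-sided forms appear so that reflection preserves the
  locale.\<close>

locale bars =
  fixes B :: "'b set" and l h :: "'b \<Rightarrow> real" and lab :: "'b \<Rightarrow> 'v" and X :: "'v set"
  assumes fin: "finite B"
    and disj: "\<lbrakk>b \<in> B; c \<in> B; l c \<le> l b + 1; l b \<le> l c + 1; h b = h c\<rbrakk> \<Longrightarrow> b = c"
    and same_right: "\<lbrakk>next_right B l h p b c; lab b \<notin> X; lab c \<notin> X\<rbrakk> \<Longrightarrow> lab b = lab c"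
    and same_left: "\<lbrakk>next_left B l h p b c; lab b \<notin> X; lab c \<notin> X\<rbrakk> \<Longrightarrow> lab b = lab c"

lemma bars_mirror: "bars B l h lab X \<Longrightarrow> bars B (mirror l) h lab X"
  unfolding bars_def next_right_mirror next_left_mirror by (auto simp: algebra_simps)

lemma bars_flip:
  assumes "bars B l h lab X"
  shows "bars B l (flip h) lab X"
proof -
  interpret bars B l h lab X by fact
  show ?thesis
  proof
    show "b = c" if "b \<in> B" "c \<in> B" "l c \<le> l b + 1" "l b \<le> l c + 1" "- h b = - h c" for b c
      using disj[of b c] that by simp
    show "lab b = lab c" if "next_right B l (flip h) p b c" "lab b \<notin> X" "lab c \<notin> X" for p b c
      using same_right[of p c b] that by (simp add: next_right_flip)
    show "lab b = lab c" if "next_left B l (flip h) p b c" "lab b \<notin> X" "lab c \<notin> X" for p b c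
      using same_left[of p c b] that by (simp add: next_left_flip)
  qed (rule fin)
qed

section \<open>Finding an end to charge for each visible pair\<close>

context bars
begin

text \<open>Descending from \<open>c\<close> to \<open>b\<close> meets only non-hubs, and neighbours
  among these share their label, so the lowest one has the label of \<open>c\<close>.\<close>

lemma next_left_same_label:
  assumes "b \<in> B" "l b < p" "p \<le> l b + 1" "c \<in> B" "l c < p" "p \<le> l c + 1" "h b < h c"
    and "lab c \<notin> X"
    and "\<And>d. d \<in> B \<Longrightarrow> l d < p \<Longrightarrow> p \<le> l d + 1 \<Longrightarrow> h b < h d \<Longrightarrow> h d < h c \<Longrightarrow> lab d \<notin> X"
  shows "\<exists>d. next_left B l h p b d \<and> lab d = lab c"
  using assms
proof (induction "card {d \<in> B. l d < p \<and> p \<le> l d + 1 \<and> h b < h d \<and> h d < h c}"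
    arbitrary: c rule: less_induct)
  case (less c)
  define S where "S = {d \<in> B. l d < p \<and> p \<le> l d + 1 \<and> h b < h d \<and> h d < h c}"
  have finS: "finite S" using fin S_def by simp
  show ?case
  proof (cases "S = {}")
    case True
    then have "next_left B l h p b c"
      unfolding next_left_def using less.prems S_def by blast
    then show ?thesis by blast
  next
    case False
    \<comment> \<open>The highest bar \<open>d\<close> in between is directly below
      \<open>c\<close>; the induction continues from \<open>d\<close>.\<close>
    then have "Max (h ` S) \<in> h ` S" using finS by simp
    then obtain d where d: "d \<in> S" and "h d = Max (h ` S)" by force
    then have top: "\<And>e. e \<in> S \<Longrightarrow> h e \<le> h d" using finS by simp
    have dB: "d \<in> B" "l d < p" "p \<le> l d + 1" "h b < h d" "h d < h c" using d S_def by auto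
    have dX: "lab d \<notin> X" using less.prems(9) dB by blast
    have "\<not> (h d < h e \<and> h e < h c)" if "e \<in> B" "l e < p" "p \<le> l e + 1" for e
      using top[of e] that dB unfolding S_def by auto
    then have "next_left B l h p d c"
      unfolding next_left_def using less.prems dB by blast
    then have lab: "lab d = lab c" using same_left dX less.prems(8) by blast
    have "{e \<in> B. l e < p \<and> p \<le> l e + 1 \<and> h b < h e \<and> h e < h d} \<subseteq> S"
      unfolding S_def using less_trans[OF _ dB(5)] by blast
    moreover have "d \<notin> {e \<in> B. l e < p \<and> p \<le> l e + 1 \<and> h b < h e \<and> h e < h d}" by simp
    ultimately have "{e \<in> B. l e < p \<and> p \<le> l e + 1 \<and> h b < h e \<and> h e < h d} \<subset> S"
      using d by blast
    then have "card {e \<in> B. l e < p \<and> p \<le> l e + 1 \<and> h b < h e \<and> h e < h d} < card S"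
      using finS psubset_card_mono by blast
    then have "\<exists>e. next_left B l h p b e \<and> lab e = lab d"
      unfolding S_def
    proof (rule less.hyps[OF _ less.prems(1-3) dB(1-4) dX])
      show "lab e \<notin> X"
        if "e \<in> B" "l e < p" "p \<le> l e + 1" "h b < h e" "h e < h d" for e
        by (rule less.prems(9)[OF that(1-4) less_trans[OF that(5) dB(5)]])
    qed
    then show ?thesis using lab by simp
  qed
qed

text \<open>If \<open>b\<close> and \<open>c\<close> both extend left of the extreme
  \<open>p\<close>, some hub must end at \<open>p\<close> between them. Otherwise \<open>b\<close>
  would still see \<open>w\<close> just left of \<open>p\<close>.\<close>

lemma leftmost:
  assumes "next_right B l h q b c" "lab c = w" "w \<notin> X"
  shows "\<exists>p c. next_right B l h p b c \<and> lab c = w \<and>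
    (\<forall>q d. next_right B l h q b d \<longrightarrow> lab d = w \<longrightarrow> p \<le> q) \<and>
    (p = l b \<or>
     (\<exists>e\<in>B. lab e \<in> X \<and> l e + 1 = p \<and> h b < h e \<and> h e < h c \<and> l b < p \<and> l c < p) \<or>
     (l c = p \<and> l b < p))"
proof -
  define S where "S = {p \<in> ends B l. \<exists>c. next_right B l h p b c \<and> lab c = w}"
  have finS: "finite S" using finite_ends[OF fin] S_def by simp
  have "S \<noteq> {}" using next_right_at_end[OF fin assms(1)] assms(2) S_def by blast
  then have "Min S \<in> S" using finS by simp
  then obtain c where c: "next_right B l h (Min S) b c" "lab c = w" using S_def by blast
  have min: "Min S \<le> q" if n: "next_right B l h q b d" "lab d = w" for q d
  proof -
    obtain p where "p \<in> S" "p \<le> q" using next_right_at_end[OF fin n(1)] n(2) S_def by blast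
    then show ?thesis using Min_le[OF finS] by force
  qed
  have "\<exists>e\<in>B. lab e \<in> X \<and> l e + 1 = Min S \<and> h b < h e \<and> h e < h c"
    if lt: "l b < Min S" "l c < Min S"
  proof (rule ccontr)
    assume none: "\<not> ?thesis"
    have "lab d \<notin> X"
      if d: "d \<in> B" "l d < Min S" "Min S \<le> l d + 1" "h b < h d" "h d < h c" for d
    proof -
      \<comment> \<open>\<open>b\<close> and \<open>c\<close> are consecutive just right of
        \<open>Min S\<close>, so \<open>d\<close> cannot continue past it.\<close>
      have "l d + 1 = Min S" using c(1) d unfolding next_right_def by force
      then show ?thesis using none d by blast
    qed
    then have "\<exists>d. next_left B l h (Min S) b d \<and> lab d = lab c"
      using next_left_same_label[of b "Min S" c] c lt assms(3) unfolding next_right_def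
      by (meson less_imp_le)
    then obtain d where d: "next_left B l h (Min S) b d" "lab d = w" using c by auto
    obtain p where "p < Min S" "next_right B l h p b d"
      using next_left_imp_next_right[OF fin d(1)] by blast
    then show False using min[of p d] d by simp
  qed
  then have "Min S = l b \<or> (\<exists>e\<in>B. lab e \<in> X \<and> l e + 1 = Min S \<and> h b < h e \<and> h e < h c \<and>
      l b < Min S \<and> l c < Min S) \<or> (l c = Min S \<and> l b < Min S)"
    if "l b \<le> Min S" "l c \<le> Min S"
    using that by (cases "l b < Min S"; cases "l c < Min S") auto
  moreover have "l b \<le> Min S" "l c \<le> Min S" using c unfolding next_right_def by auto
  ultimately show ?thesis using c min by blast
qed

text \<open>The extreme positions are \<open>p1\<close> on the left and, from the mirror image,
  \<open>- s2\<close> on the right. The left one is used only if the bar of \<open>w\<close> ends at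
  \<open>- s2\<close> inside \<open>b\<close>.\<close>

lemma charge_above:
  assumes n: "next_right B l h q b c" and b: "lab b \<in> X" and w: "lab c = w" "w \<notin> X"
  shows "\<exists>e\<in>B. lab e \<in> X \<and> (lab b, w) \<in> charge B l h lab X e"
proof -
  interpret M: bars B "mirror l" h lab X by (rule bars_mirror) unfold_locales
  have bB: "b \<in> B" using n next_right_def by metis
  obtain p1 c1 where p1: "next_right B l h p1 b c1" "lab c1 = w"
    "\<And>q d. next_right B l h q b d \<Longrightarrow> lab d = w \<Longrightarrow> p1 \<le> q"
    "p1 = l b \<or> (\<exists>e\<in>B. lab e \<in> X \<and> l e + 1 = p1 \<and> h b < h e \<and> h e < h c1 \<and> l b < p1 \<and> l c1 < p1) \<or>
     (l c1 = p1 \<and> l b < p1)"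
    using leftmost[OF n w] by blast
  have "next_left B (mirror l) h (- q) b c" using n by (simp add: next_left_mirror)
  then obtain r where r: "next_right B (mirror l) h r b c"
    using next_left_imp_next_right[OF fin] by blast
  obtain s2 c2 where s2: "next_right B (mirror l) h s2 b c2" "lab c2 = w"
    "\<And>q d. next_right B (mirror l) h q b d \<Longrightarrow> lab d = w \<Longrightarrow> s2 \<le> q"
    "s2 = mirror l b \<or> (\<exists>e\<in>B. lab e \<in> X \<and> mirror l e + 1 = s2 \<and> h b < h e \<and> h e < h c2 \<and>
       mirror l b < s2 \<and> mirror l c2 < s2) \<or> (mirror l c2 = s2 \<and> mirror l b < s2)"
    using M.leftmost[OF r w] by blast
  \<comment> \<open>Visibility just right of \<open>p1\<close> persists over some width, so the
    rightmost place lies strictly to the right.\<close>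
  have "next_left B (mirror l) h (- p1) b c1" using p1 by (simp add: next_left_mirror)
  then have p1s2: "s2 < - p1" using s2(3) p1(2) next_left_imp_next_right[OF fin]
    by (metis order_le_less_trans)
  have n2: "next_left B l h (- s2) b c2" using s2(1) by (simp add: next_right_mirror)
  consider (rs) "s2 = mirror l b"
    | (ra) e where "e \<in> B" "lab e \<in> X" "l e = - s2" "h b < h e" "h e < h c2" "mirror l b < s2" "mirror l c2 < s2"
    | (rc) "l c2 + 1 = - s2" "mirror l b < s2" using s2(4) by fastforce
  then show ?thesis
  proof cases
    case rs
    then have "(lab b, w) \<in> start B (mirror l) h lab b"
      using s2(1,2) unfolding start_def by auto
    then show ?thesis using bB b w unfolding charge_def by blast
  next
    case ra
    then have "(lab b, w) \<in> across B l h lab X e"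
      using n2 s2(2) b w unfolding across_def by force
    then show ?thesis using ra b w unfolding charge_def by blast
  next
    case rc
    \<comment> \<open>Equal lengths matter here: \<open>c2\<close> ends before \<open>b\<close>
      does, so it also starts before \<open>b\<close>.\<close>
    have less2: "l c2 < l b" using rc by simp
    \<comment> \<open>\<open>c2\<close> is present just right of \<open>p1\<close>, and
      \<open>c1\<close> just left of \<open>- s2\<close>. Each is the next bar above
      \<open>b\<close> at its own place, so the heights agree.\<close>
    have same: "c1 = c2" if "l b \<le> l c1" "p1 = l c1"
    proof -
      have c1: "c1 \<in> B" "h b < h c1" "p1 < l c1 + 1" using p1(1) unfolding next_right_def by auto
      have c2: "c2 \<in> B" "h b < h c2" using n2 unfolding next_left_def by auto
      have "h c2 \<le> h c1"
        by (rule next_left_le[OF n2 c1(1)]) (use c1 p1s2 that less2 rc in linarith)+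
      moreover have "h c1 \<le> h c2"
        by (rule next_right_le[OF p1(1) c2(1)]) (use c2 p1s2 that less2 rc in linarith)+
      ultimately show ?thesis
        by (intro disj[OF c1(1) c2(1)]) (use c1 p1s2 that less2 rc in linarith)+
    qed
    consider (ls) "p1 = l b"
    | (la) e where "e \<in> B" "lab e \<in> X" "l e + 1 = p1" "h b < h e" "h e < h c1" "l b < p1" "l c1 < p1"
    | (lc) "l c1 = p1" "l b < p1" using p1(4) by blast
    then show ?thesis
    proof cases
      case ls
      have "l c1 \<le> l b" using ls p1(1) unfolding next_right_def by blast
      \<comment> \<open>Equality would give \<open>c1 = c2\<close>, which starts before
        \<open>b\<close>; hence the strict charge applies.\<close>
      moreover have "l c1 \<noteq> l b" using same ls less2 by auto
      ultimately have "l c1 < l b" by simp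
      then have "(lab b, w) \<in> start_strict B l h lab b"
        using ls p1(1,2) unfolding start_strict_def by auto
      then have "(lab b, w) \<in> charge B l h lab X b" unfolding charge_def using b w(2) by blast
      then show ?thesis using bB b by blast
    next
      case la
      have "next_left B (mirror l) h (mirror l e) b c1"
        using p1(1) la unfolding next_left_mirror by (simp add: add.commute)
      then have "(lab b, w) \<in> across B (mirror l) h lab X e"
        unfolding across_def
        by (intro CollectI exI[of _ b] exI[of _ c1] conjI) (use la(3-) p1(2) b w in simp_all)
      then have "(lab b, w) \<in> charge B l h lab X e" unfolding charge_def using b w(2) by blast
      then show ?thesis using la(1,2) by blast
    next
      case lc
      \<comment> \<open>One bar would both start and end strictly inside the extent of
        \<open>b\<close>, contradicting equal lengths.\<close>
      have "c1 = c2" by (rule same) (use lc in linarith)+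
      then have "l c1 < l b" using less2 by metis
      then show ?thesis using lc by linarith
    qed
  qed
qed

section \<open>At most five charges per hub\<close>

lemma next_right_unique: "c = d" if "next_right B l h p b c" "next_right B l h p b d"
  using that disj[of c d] unfolding next_right_def by force

lemma start_le_one: "finite (start B l h lab e)" "card (start B l h lab e) \<le> 1"
proof -
  have "\<exists>x. start B l h lab e \<subseteq> {x}"
    unfolding start_def using next_right_unique by blast
  then show "finite (start B l h lab e)" "card (start B l h lab e) \<le> 1"
    by (auto dest: finite_subset card_mono[rotated])
qed

lemma start_strict_le_one:
  "finite (start_strict B l h lab e)" "card (start_strict B l h lab e) \<le> 1"
proof -
  have "start_strict B l h lab e \<subseteq> start B l h lab e"
    unfolding start_strict_def start_def by blast
  then show "finite (start_strict B l h lab e)" "card (start_strict B l h lab e) \<le> 1"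
    using start_le_one[of e] by (auto dest: finite_subset card_mono intro: le_trans)
qed

text \<open>If the two channels differed in height, a boundary bar of one would lie strictly inside
  the other.\<close>

lemma next_left_around_unique:
  assumes "next_left B l h p b c" "h b < y" "y < h c"
    and "next_left B l h p b' c'" "h b' < y" "y < h c'"
  shows "b = b' \<and> c = c'"
proof -
  have "h b = h b'" "h c = h c'"
    using assms unfolding next_left_def by (smt (verit))+
  then show ?thesis
    using assms disj[of b b'] disj[of c c'] unfolding next_left_def by auto
qed

text \<open>The blocked channel around \<open>h e\<close> is unique, and membership in
  \<open>X\<close> fixes the order of its pair.\<close>

lemma across_le_one:
  defines "A \<equiv> \<lambda>e. across B l h lab X e \<union> across B l (flip h) lab X e"
  shows "finite (A e)" "card (A e) \<le> 1"
proof -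
  have A: "\<exists>b c. next_left B l h (l e) b c \<and> h b < h e \<and> h e < h c \<and>
      (x = (lab b, lab c) \<and> lab b \<in> X \<and> lab c \<notin> X \<or>
       x = (lab c, lab b) \<and> lab c \<in> X \<and> lab b \<notin> X)" if "x \<in> A e" for x
    using that unfolding A_def
  proof
    assume "x \<in> across B l h lab X e"
    then show ?thesis unfolding across_def by blast
  next
    assume "x \<in> across B l (flip h) lab X e"
    then show ?thesis unfolding across_def next_left_flip neg_less_iff_less by blast
  qed
  have "x = y" if xy: "x \<in> A e" "y \<in> A e" for x y
  proof -
    obtain b c where bc: "next_left B l h (l e) b c" "h b < h e" "h e < h c"
      "x = (lab b, lab c) \<and> lab b \<in> X \<and> lab c \<notin> X \<or> x = (lab c, lab b) \<and> lab c \<in> X \<and> lab b \<notin> X"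
      using A[OF xy(1)] by blast
    obtain b' c' where bc': "next_left B l h (l e) b' c'" "h b' < h e" "h e < h c'"
      "y = (lab b', lab c') \<and> lab b' \<in> X \<and> lab c' \<notin> X \<or> y = (lab c', lab b') \<and> lab c' \<in> X \<and> lab b' \<notin> X"
      using A[OF xy(2)] by blast
    show ?thesis using next_left_around_unique[OF bc(1-3) bc'(1-3)] bc(4) bc'(4) by auto
  qed
  then have "\<exists>x. A e \<subseteq> {x}" by blast
  then show "finite (A e)" "card (A e) \<le> 1"
    by (auto dest: finite_subset card_mono[rotated])
qed

text \<open>A bar just below \<open>e\<close> that starts to the left of \<open>e\<close> would be the lower bar \<open>b\<close> of the blocked
  channel, but \<open>b\<close> is a hub.\<close>

lemma across_excludes_start_strict:
  assumes "across B l h lab X e \<noteq> {}"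
  shows "start_strict B l (flip h) lab e \<inter> X \<times> (- X) = {}"
proof (rule ccontr)
  assume "\<not> ?thesis"
  then obtain z where z: "next_right B l h (l e) z e" "l z < l e" "lab z \<notin> X"
    unfolding start_strict_def next_right_flip by auto
  obtain b c where b: "next_left B l h (l e) b c" "l e < l b + 1" "h b < h e" "h e < h c" "lab b \<in> X"
    using assms unfolding across_def by auto
  have zb: "h z = h b"
    using b z unfolding next_left_def next_right_def by force
  then have "z = b"
    using disj[of z b] b z unfolding next_left_def next_right_def by auto
  then show False using b z by simp
qed

text \<open>At the left end a blocked channel rules out the start charge on the side of its hub, so
  two charges remain; the right end has at most three.\<close>

lemma card_charge_le: "finite (charge B l h lab X e)" "card (charge B l h lab X e) \<le> 5"
proof -
  interpret F: bars B l "flip h" lab X by (rule bars_flip) unfold_locales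
  interpret M: bars B "mirror l" h lab X by (rule bars_mirror) unfold_locales
  interpret MF: bars B "mirror l" "flip h" lab X by (rule bars_flip) unfold_locales
  let ?P = "X \<times> (- X)"
  let ?s = "start_strict B l h lab e" and ?s' = "start_strict B l (flip h) lab e"
  let ?a = "across B l h lab X e \<union> across B l (flip h) lab X e"
  let ?r = "start B (mirror l) h lab e" and ?r' = "start B (mirror l) (flip h) lab e"
  let ?b = "across B (mirror l) h lab X e \<union> across B (mirror l) (flip h) lab X e"
  note fins = start_strict_le_one[of e] F.start_strict_le_one[of e] across_le_one[of e]
    M.start_le_one[of e] MF.start_le_one[of e] M.across_le_one[of e]
  have c3: "card (S \<union> T \<union> U) \<le> card S + card T + card U" for S T U :: "('v \<times> 'v) set"
    using card_Un_le[of "S \<union> T" U] card_Un_le[of S T] by linarith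
  have int: "card (S \<inter> ?P) \<le> card S" if "finite S" for S :: "('v \<times> 'v) set"
    using that by (simp add: card_mono)
  have "?a = {} \<or> ?s \<inter> ?P = {} \<or> ?s' \<inter> ?P = {}"
    using across_excludes_start_strict[of e] F.across_excludes_start_strict[of e] by auto
  then have "card (?s \<inter> ?P) + card (?s' \<inter> ?P) + card ?a \<le> 2"
    using int[of ?s] int[of ?s'] fins by auto
  moreover have "card ?r + card ?r' + card ?b \<le> 3" using fins by linarith
  moreover have sub: "charge B l h lab X e \<subseteq> (?s \<inter> ?P \<union> ?s' \<inter> ?P \<union> ?a) \<union> (?r \<union> ?r' \<union> ?b)" (is "_ \<subseteq> ?L \<union> ?R")
    unfolding charge_def by auto
  moreover have finLR: "finite (?L \<union> ?R)" using fins by simp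
  ultimately show "card (charge B l h lab X e) \<le> 5"
    using card_mono[OF finLR sub] card_Un_le[of ?L ?R] c3[of "?s \<inter> ?P" "?s' \<inter> ?P" ?a] c3[of ?r ?r' ?b]
    by linarith
  show "finite (charge B l h lab X e)" using sub finLR finite_subset by blast
qed

section \<open>Double counting and complete bipartite graphs\<close>

lemma card_pairs_le:
  assumes adj: "\<And>v w. v \<in> V \<Longrightarrow> w \<in> W \<Longrightarrow>
      \<exists>b c p. lab b = v \<and> lab c = w \<and> (next_right B l h p b c \<or> next_right B l h p c b)"
    and "V \<subseteq> X" "W \<inter> X = {}"
  shows "card V * card W \<le> 5 * card {b \<in> B. lab b \<in> X}"
proof -
  interpret F: bars B l "flip h" lab X by (rule bars_flip) unfold_locales
  let ?H = "{b \<in> B. lab b \<in> X}"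
  have "V \<times> W \<subseteq> (\<Union>e\<in>?H. charge B l h lab X e)"
  proof safe
    fix v w assume vw: "v \<in> V" "w \<in> W"
    obtain b c p where bc: "lab b = v" "lab c = w" "next_right B l h p b c \<or> next_right B l h p c b"
      using adj[OF vw] by blast
    have X: "v \<in> X" "w \<notin> X" using assms vw by auto
    show "(v, w) \<in> (\<Union>e\<in>?H. charge B l h lab X e)"
      using bc(3)
    proof
      assume "next_right B l h p b c"
      then show ?thesis using charge_above[of p b c w] bc X by auto
    next
      assume "next_right B l h p c b"
      \<comment> \<open>A hub seen from below is handled upside down, since the charges are
        invariant under \<open>flip\<close>.\<close>
      then have "next_right B l (flip h) p b c" by (simp add: next_right_flip)
      then show ?thesis using F.charge_above[of p b c w] bc X by (auto simp: charge_flip)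
    qed
  qed
  moreover have finH: "finite ?H" using fin by simp
  then have "finite (\<Union>e\<in>?H. charge B l h lab X e)" using card_charge_le(1) by blast
  ultimately have "card (V \<times> W) \<le> card (\<Union>e\<in>?H. charge B l h lab X e)"
    by (rule card_mono[rotated])
  also have "\<dots> \<le> (\<Sum>e\<in>?H. card (charge B l h lab X e))" by (rule card_UN_le[OF finH])
  also have "\<dots> \<le> (\<Sum>e\<in>?H. 5)" by (rule sum_mono) (rule card_charge_le(2))
  finally show ?thesis by (simp add: card_cartesian_product)
qed

end

text \<open>Taking the part of size \<open>n\<close> as hubs bounds the number of hubs by
  \<open>n * t\<close>; cancelling \<open>n\<close> from the count of pairs leaves the
  claim.\<close>

lemma complete_bipartite_unit_bar_rep:
  assumes K: "K\<^bsub>m,n\<^esub> G" and "0 < n" and R: "unit_bar_rep t G R"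
  shows "m \<le> 5 * t"
proof -
  obtain U V where UV: "verts G = U \<union> V" "U \<inter> V = {}" "card U = m" "card V = n"
    "arcs_ends G = U \<times> V \<union> V \<times> U" and G: "graph G"
    using K unfolding complete_bipartite_digraph_def by blast
  interpret graph G by fact
  \<comment> \<open>Bars are paired with their vertices, so that \<open>fst\<close> is the
    labelling.\<close>
  define B where "B = Sigma (verts G) R"
  note rep = R[unfolded unit_bar_rep_def]
  have finR: "finite (R v)" "card (R v) \<le> t" "\<And>b. b \<in> R v \<Longrightarrow> unit_bar b" if "v \<in> verts G" for v
    using conjunct1[OF rep] that by simp_all
  have finB: "finite B" unfolding B_def using finR finite_verts by blast
  have "\<forall>b\<in>B. \<exists>q. snd b = {fst q..fst q + 1} \<times> {snd q}"
    using finR(3) unfolding B_def unit_bar_def by fastforce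
  then obtain q where q: "\<And>b. b \<in> B \<Longrightarrow> snd b = {fst (q b)..fst (q b) + 1} \<times> {snd (q b)}"
    by metis
  define l where "l = fst \<circ> q"
  define h where "h = snd \<circ> q"
  have bar: "snd b = {l b..l b + 1} \<times> {h b}" if "b \<in> B" for b
    using q[OF that] unfolding l_def h_def by simp
  have all: "(\<Union>w\<in>verts G. R w) = snd ` B" unfolding B_def by force
  have adj: "u \<rightarrow>\<^bsub>G\<^esub> v \<longleftrightarrow> (\<exists>b\<in>R u. \<exists>c\<in>R v. sees (snd ` B) b c)"
    if "u \<in> verts G" "v \<in> verts G" "u \<noteq> v" for u v
    using conjunct2[OF conjunct2[OF rep]] that unfolding all by simp
  have same_right: "fst b = fst c" if n: "next_right B l h p b c" and V: "fst b \<notin> V" "fst c \<notin> V" for p b c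
  proof (rule ccontr)
    assume ne: "fst b \<noteq> fst c"
    have B: "b \<in> B" "c \<in> B" using n unfolding next_right_def by auto
    then have bc: "fst b \<in> verts G" "fst c \<in> verts G" "snd b \<in> R (fst b)" "snd c \<in> R (fst c)"
      unfolding B_def by auto
    have "sees (snd ` B) (snd b) (snd c)"
      unfolding sees_def using next_right_imp_sees_above[OF finB bar n] by simp
    then have "fst b \<rightarrow>\<^bsub>G\<^esub> fst c" using adj ne bc by blast
    then show False using UV V by auto
  qed
  interpret bars B l h fst V
  proof
    show "finite B" by fact
    show "fst b = fst c" if "next_right B l h p b c" "fst b \<notin> V" "fst c \<notin> V" for p b c
      using same_right that .
    show "fst b = fst c" if "next_left B l h p b c" "fst b \<notin> V" "fst c \<notin> V" for p b c
      using next_left_imp_next_right[OF finB that(1)] same_right that(2,3) by blast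
    show "b = c" if bc: "b \<in> B" "c \<in> B" "l c \<le> l b + 1" "l b \<le> l c + 1" "h b = h c" for b c
    proof (rule ccontr)
      assume "b \<noteq> c"
      then have "snd b \<inter> snd c = {}"
        using conjunct1[OF conjunct2[OF rep]] bc(1,2) unfolding disjoint_family_on_def B_def by blast
      \<comment> \<open>The larger left end is a common point of two touching or overlapping bars at
        equal height.\<close>
      moreover have "(max (l b) (l c), h b) \<in> snd b \<inter> snd c"
        using bc by (auto simp: bar)
      ultimately show False by blast
    qed
  qed
  have "\<exists>b c p. fst b = v \<and> fst c = w \<and> (next_right B l h p b c \<or> next_right B l h p c b)"
    if vw: "v \<in> V" "w \<in> U" for v w
  proof -
    have "v \<rightarrow>\<^bsub>G\<^esub> w" "v \<in> verts G" "w \<in> verts G" "v \<noteq> w" using UV vw by auto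
    then obtain b c where bc: "b \<in> R v" "c \<in> R w" "sees (snd ` B) b c" using adj by blast
    then have B: "(v, b) \<in> B" "(w, c) \<in> B" using UV vw unfolding B_def by auto
    have "\<exists>p. next_right B l h p (v, b) (w, c) \<or> next_right B l h p (w, c) (v, b)"
      using bc(3) sees_above_imp_next_right[where bar = snd, OF bar] B unfolding sees_def by fastforce
    then show ?thesis by fastforce
  qed
  then have "card V * card U \<le> 5 * card {b \<in> B. fst b \<in> V}"
    using card_pairs_le[of V U] UV(2) by blast
  also have "{b \<in> B. fst b \<in> V} = Sigma V R" using UV(1) unfolding B_def by auto
  also have "card (Sigma V R) = (\<Sum>v\<in>V. card (R v))"
    using UV(1) finite_verts finR(1) by (intro card_SigmaI) auto
  also have "\<dots> \<le> (\<Sum>v\<in>V. t)" using UV(1) finR(2) by (intro sum_mono) auto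
  finally have "n * m \<le> n * (5 * t)" using UV by (simp add: algebra_simps)
  then show ?thesis using \<open>0 < n\<close> by simp
qed

theorem theorem19:
  fixes G :: "('a, 'b) pre_digraph" and m n :: nat
  assumes "2 \<le> n" and "n \<le> m" and "K\<^bsub>m,n\<^esub> G"
  shows "int (ub G) \<ge> \<lceil>real m / 5\<rceil>"
proof -
  have "graph G" using assms(3) unfolding complete_bipartite_digraph_def by blast
  then obtain R where "unit_bar_rep (ub G) G R" using unit_bar_rep_ub by blast
  then have "m \<le> 5 * ub G" using complete_bipartite_unit_bar_rep assms by fastforce
  then show ?thesis by (simp add: ceiling_le_iff)
qed

end
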